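(* Let $n\geq 1$ be an integer, let $p\in[1,+\infty]$ and let $f\in L^p(\mathbb{C},d\lambda)$. Then $B_n f=f$ if and only if $f$ is harmonic on $\mathbb{C}$.
   Context: $\lambda$ is the Lebesgue area measure on $\mathbb{C}\simeq\mathbb{R}^2$ and $d\mu(z)=\frac{e^{-|z|^2}}{\pi}\,d\lambda(z)$ is the Gaussian probability measure; $\langle f,g\rangle=\int_{\mathbb{C}} f\overline{g}\,d\mu$. The generalized Laguerre polynomials are $L^\beta_k(x)=\sum_{j=0}^{k}\binom{k+\beta}{k-j}\frac{(-x)^j}{j!}$. For $n\geq1$, the $n$-analytic Fock space $F^2_n(\mathbb{C})$ is the closed subspace of $L^2(\mathbb{C},d\mu)$ of functions $f$ with $\partial^n f/\partial\overline{z}^n=0$ on $\mathbb{C}$; its reproducing kernel is $K_n(z,w)=L^1_{n-1}(|z-w|^2)e^{z\overline{w}}$. The normalized kernel is $k^n_z(w)=K_n(w,z)/\sqrt{K_n(z,z)}$. The Berezin transform of $f\in L^p(\mathbb{C},d\lambda)$ is $B_nf(z)=\langle f k_z^n,k_z^n\rangle=\int_{\mathbb{C}} f\,|k^n_z|^2\,d\mu$, $z\in\mathbb{C}$. Functions are complex-valued and, as usual, elements of $L^p$ are identified when equal almost everywhere (so "$f$ is harmonic" means $f$ coincides almost everywhere with a harmonic function). *)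

theory Defs
  imports "HOL-Analysis.Analysis"
begin

definition Lp_fun :: "ennreal \<Rightarrow> 'a measure \<Rightarrow> ('a \<Rightarrow> complex) \<Rightarrow> bool" where
  "Lp_fun p M f \<longleftrightarrow> f \<in> borel_measurable M \<and>
     (if p = \<infinity> then \<exists>C. AE x in M. cmod (f x) \<le> C
      else integrable M (\<lambda>x. cmod (f x) powr enn2real p))"

text \<open>Complex-valued harmonic functions: \<open>C\<^sup>2\<close> functions in the real sense (the second derivative
  is the Frechet derivative of the first), annihilated by the Laplacian, i.e. by the trace
  of the second derivative over the real basis \<open>1\<close>, \<open>\<i>\<close> of the plane.\<close>

definition harmonic_on :: "(complex \<Rightarrow> complex) \<Rightarrow> complex set \<Rightarrow> bool" (infixl "harmonic'_on" 50) where
  "f harmonic_on S \<longleftrightarrow> open S \<and>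
     (\<exists>(f' :: complex \<Rightarrow> complex \<Rightarrow>\<^sub>L complex) (f'' :: complex \<Rightarrow> complex \<Rightarrow>\<^sub>L complex \<Rightarrow>\<^sub>L complex).
        (\<forall>z\<in>S. (f has_derivative blinfun_apply (f' z)) (at z)) \<and>
        (\<forall>z\<in>S. (f' has_derivative blinfun_apply (f'' z)) (at z)) \<and>
        continuous_on S f'' \<and>
        (\<forall>z\<in>S. blinfun_apply (blinfun_apply (f'' z) 1) 1 + blinfun_apply (blinfun_apply (f'' z) \<i>) \<i> = 0))"

definition gaussian_measure :: "complex measure" where
  "gaussian_measure = density lebesgue (\<lambda>z. ennreal (exp (- (cmod z)\<^sup>2) / pi))"

definition gaussian_inner :: "(complex \<Rightarrow> complex) \<Rightarrow> (complex \<Rightarrow> complex) \<Rightarrow> complex" where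
  "gaussian_inner f g = (LINT z|gaussian_measure. f z * cnj (g z))"

definition gen_laguerre :: "real \<Rightarrow> nat \<Rightarrow> real \<Rightarrow> real" where
  "gen_laguerre \<beta> k x = (\<Sum>j\<le>k. ((real k + \<beta>) gchoose (k - j)) * (- x) ^ j / fact j)"

text \<open>For \<open>n \<ge> 1\<close>, the reproducing kernel of the \<open>n\<close>-analytic Fock space, i.e. of the closed subspace
  of \<open>L\<^sup>2\<close> of the Gaussian measure consisting of the functions annihilated by the \<open>n\<close>-th power
  of the Cauchy-Riemann operator.\<close>

definition fock_kernel :: "nat \<Rightarrow> complex \<Rightarrow> complex \<Rightarrow> complex" where
  "fock_kernel n z w = of_real (gen_laguerre 1 (n - 1) ((cmod (z - w))\<^sup>2)) * exp (z * cnj w)"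

text \<open>\<open>fock_kernel n z z\<close> is a nonnegative real, on which \<open>csqrt\<close> is the real square root.\<close>

definition normalized_fock_kernel :: "nat \<Rightarrow> complex \<Rightarrow> complex \<Rightarrow> complex" where
  "normalized_fock_kernel n z w = fock_kernel n w z / csqrt (fock_kernel n z z)"

definition berezin :: "nat \<Rightarrow> (complex \<Rightarrow> complex) \<Rightarrow> complex \<Rightarrow> complex" where
  "berezin n f z =
     gaussian_inner (\<lambda>w. f w * normalized_fock_kernel n z w) (normalized_fock_kernel n z)"

end

(*
  Completing the square shows that B_n f is the convolution of f with the radial function
  phi(w) = L^1_{n-1}(|w|^2)^2 exp(-|w|^2) / (n pi), which is continuous, bounded, positive near 0
  and of total mass 1.  Harmonic functions reproduce under radial averages of mass 1.
  Conversely, if B_n f = f then f = phi * f is bounded, since phi lies in all L^q, and uniformly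
  continuous, since phi translates continuously in L^1; a bounded uniformly continuous function
  which is a fixed point of convolution with such a phi is constant (Choquet-Deny).
*)

theory Submission
  imports Defs "HOL-Probability.Distributions"
begin

section \<open>Lebesgue measure on the plane\<close>

text \<open>Polar coordinates enter in two disguises. The mass of the weight is computed by pushing
  area forward under the squared modulus; means of harmonic functions come from integrating over an
  extra rotation angle and exchanging the order of integration, which is where invariance of area
  under rotations is used. The weight vanishes on circles wherever the Laguerre polynomial has a
  positive zero, so a positive lower bound is at hand only near 0. Hence the Choquet-Deny argument
  works with short translations and iterates them. That argument needs identities at every point,
  whereas \<open>f\<close> is known only up to null sets. It is therefore applied to
  \<open>berezin n f\<close>, which is defined everywhere and agrees almost everywhere with
  \<open>f\<close>. All exponents are treated alike: \<open>f\<close> is dominated by a constant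
  plus an integrable function, and the weight is both integrable and bounded.\<close>

lemma nn_integral_lborel_translate:
  fixes t :: "'a::euclidean_space"
  assumes [measurable]: "g \<in> borel_measurable borel"
  shows "(\<integral>\<^sup>+x. g (t + x) \<partial>lborel) = (\<integral>\<^sup>+x. g x \<partial>lborel)"
  by (subst (2) lborel_distr_plus[of t, symmetric]) (simp add: nn_integral_distr)

text \<open>Uniqueness of Haar measure, specialised to the image of Lebesgue measure under an isometry
  that fixes the unit ball: by Tonelli and translation invariance, both measures of \<open>A\<close>
  agree after multiplication by the volume of the unit ball.\<close>

lemma lborel_distr_orthogonal_transformation:
  fixes f :: "'a::euclidean_space \<Rightarrow> 'a"
  assumes f: "orthogonal_transformation f"
  shows "distr lborel borel f = lborel"
proof (rule measure_eqI)
  have lin: "linear f" and norm_f: "\<And>v. norm (f v) = norm v"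
    using f by (auto simp: orthogonal_transformation)
  have [measurable]: "f \<in> borel_measurable borel"
    using lin by (intro borel_measurable_continuous_onI linear_continuous_on linear_conv_bounded_linear[THEN iffD1])
  define c where "c = emeasure lborel (ball 0 1 :: 'a set)"
  have c_eq: "emeasure lborel (ball x 1 :: 'a set) = c" for x
    by (simp add: c_def emeasure_ball)
  have c: "c \<noteq> 0" "c \<noteq> \<infinity>"
    using unit_ball_vol_pos[of "real DIM('a)"] by (auto simp: c_def emeasure_ball simp del: unit_ball_vol_pos)
  fix A assume "A \<in> sets (distr lborel borel f)"
  then have [measurable]: "A \<in> sets borel" by simp
  define I :: "'a set \<Rightarrow> 'a \<Rightarrow> ennreal" where "I = indicator"
  have [measurable]: "I A \<in> borel_measurable borel" "I (ball 0 1) \<in> borel_measurable borel"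
    by (auto simp: I_def intro!: borel_measurable_indicator)
  \<comment> \<open>Writing \<open>x\<close> as \<open>f u\<close> turns the shift of the image into
    a shift of the integration variable.\<close>
  have shift: "(\<integral>\<^sup>+y. I A (x + f y) \<partial>lborel) = (\<integral>\<^sup>+y. I A (f y) \<partial>lborel)" for x
  proof -
    obtain u where u: "f u = x"
      using orthogonal_transformation_surj[OF f] by (metis surjD)
    show ?thesis
      using nn_integral_lborel_translate[of "\<lambda>y. I A (f y)" u] by (simp add: linear_add[OF lin] u)
  qed
  have ball: "(\<integral>\<^sup>+y. I (ball 0 1) (x - f y) \<partial>lborel) = c" for x
  proof -
    obtain u where u: "f u = x"
      using orthogonal_transformation_surj[OF f] by (metis surjD)
    have "I (ball 0 1) (x - f y) = indicator (ball u 1) y" for y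
      by (auto simp: I_def indicator_def dist_norm norm_f simp flip: u linear_diff[OF lin])
    then show ?thesis by (simp add: c_eq)
  qed
  have "c * emeasure (distr lborel borel f) A = c * (\<integral>\<^sup>+y. I A (f y) \<partial>lborel)"
    by (simp add: nn_integral_indicator[symmetric] nn_integral_distr I_def del: nn_integral_indicator)
  also have "\<dots> = (\<integral>\<^sup>+x. I (ball 0 1) x * (\<integral>\<^sup>+y. I A (x + f y) \<partial>lborel) \<partial>lborel)"
    unfolding shift by (subst nn_integral_multc) (auto simp: I_def c_def intro!: borel_measurable_indicator)
  also have "\<dots> = (\<integral>\<^sup>+x. \<integral>\<^sup>+y. I (ball 0 1) x * I A (x + f y) \<partial>lborel \<partial>lborel)"
    by (subst nn_integral_cmult) simp_all
  also have "\<dots> = (\<integral>\<^sup>+y. \<integral>\<^sup>+x. I (ball 0 1) x * I A (x + f y) \<partial>lborel \<partial>lborel)"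
    by (rule lborel_pair.Fubini'[symmetric]) measurable
  also have "\<dots> = (\<integral>\<^sup>+y. \<integral>\<^sup>+x. I (ball 0 1) (x - f y) * I A x \<partial>lborel \<partial>lborel)"
    by (rule nn_integral_cong, subst nn_integral_lborel_translate[of "\<lambda>x. I (ball 0 1) x * I A (x + f y)" "- f y" for y, symmetric])
       simp_all
  also have "\<dots> = (\<integral>\<^sup>+x. \<integral>\<^sup>+y. I (ball 0 1) (x - f y) * I A x \<partial>lborel \<partial>lborel)"
    by (rule lborel_pair.Fubini'[symmetric]) measurable
  also have "\<dots> = (\<integral>\<^sup>+x. c * I A x \<partial>lborel)"
    by (subst nn_integral_multc) (simp_all add: ball)
  also have "\<dots> = c * emeasure lborel A"
    by (subst nn_integral_cmult) (simp_all add: I_def)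
  finally show "emeasure (distr lborel borel f) A = emeasure lborel A"
    using c by (simp add: ennreal_mult_cancel_left)
qed simp

text \<open>A disc of radius \<open>sqrt a\<close> has area \<open>pi * a\<close>, and closed
  half-lines generate the Borel sets. This takes the place of polar coordinates for integrands
  depending only on the modulus.\<close>

lemma distr_lborel_cmod_square:
  "distr lborel borel (\<lambda>w. (cmod w)\<^sup>2) = density lborel (\<lambda>x. ennreal pi * indicator {0..} x)"
proof (rule measure_eqI_generator_eq)
  let ?E = "range (\<lambda>a::real. {..a})"
  show "Int_stable ?E" by (auto simp: Int_stable_def)
  show "?E \<subseteq> Pow UNIV" by simp
  show "sets (distr lborel borel (\<lambda>w. (cmod w)\<^sup>2)) = sigma_sets UNIV ?E"
       "sets (density lborel (\<lambda>x. ennreal pi * indicator {0..} x)) = sigma_sets UNIV ?E"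
    by (simp_all add: borel_eq_atMost)
  have eq: "emeasure (distr lborel borel (\<lambda>w. (cmod w)\<^sup>2)) {..a} = ennreal (pi * max 0 a)" for a
  proof -
    have "(\<lambda>w. (cmod w)\<^sup>2) -` {..a} = (if a < 0 then {} else cball 0 (sqrt a))"
      by (auto simp: real_le_rsqrt) (smt (verit) zero_le_power2, use sqrt_ge_absD in force)
    then show ?thesis
      by (auto simp: emeasure_distr emeasure_cball unit_ball_vol_numeral max_def)
  qed
  show "range (\<lambda>i::nat. {..real i}) \<subseteq> ?E" by auto
  show "(\<Union>i::nat. {..real i}) = UNIV" by (auto simp: real_arch_simple)
  show "emeasure (distr lborel borel (\<lambda>w. (cmod w)\<^sup>2)) {..real i} \<noteq> \<infinity>" for i
    by (simp add: eq)
  fix X assume "X \<in> ?E"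
  then obtain a where X: "X = {..a}" by auto
  have "emeasure (density lborel (\<lambda>x. ennreal pi * indicator {0..} x)) {..a} =
      ennreal pi * (\<integral>\<^sup>+x. indicator {0..a} x \<partial>lborel)"
    by (simp add: emeasure_density mult.assoc nn_integral_cmult atLeastAtMost_def flip: indicator_inter_arith)
  also have "\<dots> = ennreal (pi * max 0 a)"
    by (auto simp: max_def ennreal_mult)
  finally show "emeasure (distr lborel borel (\<lambda>w. (cmod w)\<^sup>2)) X =
      emeasure (density lborel (\<lambda>x. ennreal pi * indicator {0..} x)) X"
    by (simp add: X eq)
qed

text \<open>In the variable \<open>x = (cmod w)\<^sup>2\<close> this is \<open>pi\<close> times the
  Gamma integral for \<open>fact m\<close>.\<close>

lemma has_bochner_integral_gaussian_moment:
  "has_bochner_integral lborel (\<lambda>w::complex. ((cmod w)\<^sup>2) ^ m * exp (- (cmod w)\<^sup>2)) (pi * fact m)"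
proof (rule has_bochner_integral_nn_integral)
  have "(\<integral>\<^sup>+w. ennreal (((cmod w)\<^sup>2) ^ m * exp (- (cmod w)\<^sup>2)) \<partial>lborel) =
     (\<integral>\<^sup>+x. ennreal (x ^ m * exp (- x)) \<partial>distr lborel borel (\<lambda>w. (cmod w)\<^sup>2))"
    by (subst nn_integral_distr) simp_all
  also have "\<dots> = (\<integral>\<^sup>+x. ennreal pi * (ennreal (x ^ m * exp (- x)) * indicator {0..} x) \<partial>lborel)"
    unfolding distr_lborel_cmod_square by (subst nn_integral_density) (auto simp: mult_ac)
  also have "\<dots> = ennreal pi * ennreal (fact m)"
    by (subst nn_integral_cmult) (simp_all add: nn_intergal_power_times_exp_Ici)
  finally show "(\<integral>\<^sup>+w. ennreal (((cmod w)\<^sup>2) ^ m * exp (- (cmod w)\<^sup>2)) \<partial>lborel) =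
      ennreal (pi * fact m)"
    by (simp add: ennreal_mult)
qed auto

section \<open>The Berezin transform as a convolution\<close>

text \<open>Up to sign this is an \<open>n\<close>-th finite difference of a polynomial of degree
  \<open>i < n\<close>. Pascal's rule is used twice: on the row \<open>n\<close>, to turn the sum
  into one over differences, and on the generalized binomial, to lower \<open>i\<close>.\<close>

lemma alternating_sum_binomial_gchoose:
  fixes a :: real
  assumes "i < n"
  shows "(\<Sum>j\<le>n. (-1) ^ j * real (n choose j) * ((a + real j) gchoose i)) = 0"
  using assms
proof (induction n arbitrary: a i)
  case (Suc n)
  have pascal: "(\<Sum>j\<le>Suc n. (-1) ^ j * real (Suc n choose j) * g j) =
      (\<Sum>j\<le>n. (-1) ^ j * real (n choose j) * (g j - g (Suc j)))" for g :: "nat \<Rightarrow> real"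
  proof -
    have "(\<Sum>j\<le>Suc n. (-1) ^ j * real (Suc n choose j) * g j) =
        g 0 + (\<Sum>j\<le>n. (-1) ^ Suc j * real (n choose Suc j) * g (Suc j))
        - (\<Sum>j\<le>n. (-1) ^ j * real (n choose j) * g (Suc j))"
      by (subst sum.atMost_Suc_shift) (simp add: ring_distribs sum.distrib sum_negf sum_subtractf)
    also have "g 0 + (\<Sum>j\<le>n. (-1) ^ Suc j * real (n choose Suc j) * g (Suc j)) =
        (\<Sum>j\<le>Suc n. (-1) ^ j * real (n choose j) * g j)"
      by (simp add: sum.atMost_Suc_shift del: sum.atMost_Suc)
    also have "\<dots> = (\<Sum>j\<le>n. (-1) ^ j * real (n choose j) * g j)"
      by simp
    finally show ?thesis
      by (simp add: sum_subtractf ring_distribs)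
  qed
  show ?case
  proof (cases i)
    case 0
    then show ?thesis using pascal[of "\<lambda>_. 1"] by (simp del: sum.atMost_Suc)
  next
    case (Suc k)
    have "((a + real j) gchoose i) - ((a + real (Suc j)) gchoose i) = - ((a + real j) gchoose k)" for j
      using gbinomial_Suc_Suc[of "a + real j" k] by (simp add: Suc add_ac)
    then have "(\<Sum>j\<le>Suc n. (-1) ^ j * real (Suc n choose j) * ((a + real j) gchoose i)) =
       - (\<Sum>j\<le>n. (-1) ^ j * real (n choose j) * ((a + real j) gchoose k))"
      unfolding pascal by (simp add: sum_negf del: sum.atMost_Suc)
    then show ?thesis using Suc.IH[of k a] Suc.prems Suc by simp
  qed
qed simp

text \<open>Since \<open>x ^ i / fact i\<close> times \<open>x ^ j / fact j\<close> integrates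
  against \<open>exp (- x)\<close> to a binomial coefficient, this says that the Laguerre polynomial
  of order 1 and degree \<open>n - 1\<close> reproduces the value at 0 of polynomials of degree
  below \<open>n\<close> on the half-line.\<close>

lemma alternating_sum_binomial_shifted:
  assumes "i < n"
  shows "(\<Sum>j<n. (-1) ^ j * real (n choose Suc j) * real ((i + j) choose i)) = (if i = 0 then 1 else 0)"
proof -
  \<comment> \<open>With this shift the term \<open>j = 0\<close> of the vanishing alternating sum
    is the right-hand side, and the remaining terms are the required sum up to sign.\<close>
  define a where "a = real i - 1"
  have a: "((a + real (Suc j)) gchoose i) = real ((i + j) choose i)" for j
    by (simp add: a_def binomial_gbinomial add_ac)
  have "a gchoose i = (if i = 0 then 1 else 0)"
    using binomial_gbinomial[of "i - 1" i, where 'a = real] by (auto simp: a_def of_nat_diff binomial_eq_0)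
  moreover have "0 = (\<Sum>j\<le>n. (-1) ^ j * real (n choose j) * ((a + real j) gchoose i))"
    using alternating_sum_binomial_gchoose[OF assms, of a] by simp
  moreover have "\<dots> = (a gchoose i) - (\<Sum>j<n. (-1) ^ j * real (n choose Suc j) * real ((i + j) choose i))"
    unfolding lessThan_Suc_atMost[symmetric]
    by (subst sum.lessThan_Suc_shift) (simp add: a sum_negf del: of_nat_Suc)
  ultimately show ?thesis by simp
qed

text \<open>The factor \<open>real n\<close> is the value of the Laguerre polynomial at 0, coming
  from the kernel on the diagonal.\<close>

definition berezin_weight :: "nat \<Rightarrow> complex \<Rightarrow> real" where
  "berezin_weight n w =
     (gen_laguerre 1 (n - 1) ((cmod w)\<^sup>2))\<^sup>2 * exp (- (cmod w)\<^sup>2) / (real n * pi)"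

lemma gen_laguerre_1:
  assumes "n \<ge> 1"
  shows "gen_laguerre 1 (n - 1) x = (\<Sum>j<n. (-1) ^ j * real (n choose Suc j) * (x ^ j / fact j))"
proof -
  have "{..n - 1} = {..<n}" using assms by auto
  moreover have "((real (n - 1) + 1) gchoose (n - 1 - j)) = real (n choose Suc j)" if "j < n" for j
    using that binomial_symmetric[of "Suc j" n] by (simp add: binomial_gbinomial of_nat_diff)
  ultimately show ?thesis
    unfolding gen_laguerre_def by (auto simp: power_minus[of x] intro!: sum.cong)
qed

lemma continuous_on_berezin_weight [continuous_intros]:
  "continuous_on S f \<Longrightarrow> continuous_on S (\<lambda>x. berezin_weight n (f x))"
  unfolding berezin_weight_def gen_laguerre_def divide_inverse by (intro continuous_intros)

lemma berezin_weight_nonneg: "0 \<le> berezin_weight n w"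
  by (simp add: berezin_weight_def)

lemma berezin_weight_rotate: "cmod u = 1 \<Longrightarrow> berezin_weight n (u * w) = berezin_weight n w"
  by (simp add: berezin_weight_def norm_mult)

lemma gen_laguerre_1_at_0:
  assumes "n \<ge> 1"
  shows "gen_laguerre 1 (n - 1) 0 = real n"
proof -
  have "gen_laguerre 1 (n - 1) 0 = (\<Sum>j<n. if j = 0 then real n else 0)"
    unfolding gen_laguerre_1[OF assms] by (intro sum.cong) auto
  then show ?thesis using assms by simp
qed

lemma berezin_weight_at_0:
  assumes "n \<ge> 1"
  shows "berezin_weight n 0 > 0"
  using gen_laguerre_1_at_0[OF assms] assms by (simp add: berezin_weight_def)

lemma power_div_fact_le_exp:
  fixes x :: real
  assumes "x \<ge> 0"
  shows "x ^ j / fact j \<le> exp x"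
proof -
  have "(\<Sum>i\<in>{j}. x ^ i /\<^sub>R fact i) \<le> exp x"
    unfolding exp_def by (rule sum_le_suminf) (use assms in \<open>auto intro: summable_exp\<close>)
  then show ?thesis by (simp add: divide_inverse mult.commute)
qed

text \<open>Using \<open>power_div_fact_le_exp\<close> at \<open>x / 2\<close> costs the factors
  \<open>2 ^ j\<close> in \<open>S\<close>, but leaves a bound \<open>S * exp (x / 2)\<close> on the
  polynomial whose square the Gaussian cancels exactly.\<close>

lemma berezin_weight_bounded:
  assumes "n \<ge> 1"
  shows "\<exists>K. \<forall>w. berezin_weight n w \<le> K"
proof (intro exI allI)
  fix w
  define x where "x = (cmod w)\<^sup>2"
  define S where "S = (\<Sum>j<n. real (n choose Suc j) * 2 ^ j)"
  have x: "x \<ge> 0" by (simp add: x_def)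
  have "\<bar>gen_laguerre 1 (n - 1) x\<bar> \<le> (\<Sum>j<n. real (n choose Suc j) * (x ^ j / fact j))"
    unfolding gen_laguerre_1[OF assms]
    by (rule order_trans[OF sum_abs]) (use x in \<open>simp add: abs_mult\<close>)
  also have "\<dots> \<le> (\<Sum>j<n. real (n choose Suc j) * (2 ^ j * exp (x / 2)))"
  proof (intro sum_mono mult_left_mono)
    fix j
    show "x ^ j / fact j \<le> 2 ^ j * exp (x / 2)"
      using power_div_fact_le_exp[of "x / 2" j] x by (simp add: power_divide field_simps)
  qed simp
  also have "\<dots> = S * exp (x / 2)"
    by (simp add: S_def sum_distrib_right mult.assoc)
  finally have "(gen_laguerre 1 (n - 1) x)\<^sup>2 \<le> (S * exp (x / 2))\<^sup>2"
    by (rule abs_le_square_iff[THEN iffD1, OF order_trans]) simp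
  also have "\<dots> = S\<^sup>2 * exp x"
    by (simp add: power_mult_distrib flip: exp_double)
  finally have "(gen_laguerre 1 (n - 1) x)\<^sup>2 * exp (- x) \<le> S\<^sup>2"
    by (simp add: exp_minus field_simps)
  then show "berezin_weight n w \<le> S\<^sup>2 / (real n * pi)"
    using assms unfolding berezin_weight_def x_def by (intro divide_right_mono) auto
qed

text \<open>One factor of the squared Laguerre polynomial acts as reproducing kernel on the other,
  so the square integrates to the value at 0, namely \<open>n\<close>, which the normalization
  cancels.\<close>

lemma has_bochner_integral_berezin_weight:
  assumes "n \<ge> 1"
  shows "has_bochner_integral lborel (berezin_weight n) 1"
proof -
  define c where "c j = (-1) ^ j * real (n choose Suc j)" for j
  have expand: "berezin_weight n w = (\<Sum>i<n. \<Sum>j<n. (c i * c j / (fact i * fact j * real n * pi)) *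
          (((cmod w)\<^sup>2) ^ (i + j) * exp (- (cmod w)\<^sup>2)))" for w
  proof -
    let ?t = "\<lambda>j. c j * (((cmod w)\<^sup>2) ^ j / fact j)"
    have "berezin_weight n w = (\<Sum>i<n. \<Sum>j<n. ?t i * ?t j) * (exp (- (cmod w)\<^sup>2) / (real n * pi))"
      unfolding berezin_weight_def gen_laguerre_1[OF assms] sum_product[symmetric] c_def
      by (simp add: power2_eq_square[of "sum _ _"])
    then show ?thesis
      unfolding sum_distrib_right by (auto simp: power_add mult_ac intro!: sum.cong)
  qed
  have "has_bochner_integral lborel
      (\<lambda>w. \<Sum>i<n. \<Sum>j<n. (c i * c j / (fact i * fact j * real n * pi)) *
          (((cmod w)\<^sup>2) ^ (i + j) * exp (- (cmod w)\<^sup>2)))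
      (\<Sum>i<n. \<Sum>j<n. (c i * c j / (fact i * fact j * real n * pi)) * (pi * fact (i + j)))"
    by (intro has_bochner_integral_sum has_bochner_integral_mult_right
        has_bochner_integral_gaussian_moment)
  also have "(\<lambda>w. \<Sum>i<n. \<Sum>j<n. (c i * c j / (fact i * fact j * real n * pi)) *
          (((cmod w)\<^sup>2) ^ (i + j) * exp (- (cmod w)\<^sup>2))) = berezin_weight n"
    by (intro ext) (simp only: expand)
  also have "(\<Sum>i<n. \<Sum>j<n. (c i * c j / (fact i * fact j * real n * pi)) * (pi * fact (i + j))) =
      (\<Sum>i<n. c i * (\<Sum>j<n. c j * real ((i + j) choose i)) / real n)"
    unfolding sum_distrib_left sum_divide_distrib
    by (intro sum.cong refl) (simp add: binomial_fact field_simps)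
  \<comment> \<open>Only \<open>i = 0\<close> survives, with coefficient
    \<open>c 0 = n\<close>.\<close>
  also have "\<dots> = (\<Sum>i<n. if i = 0 then 1 else 0)"
    using alternating_sum_binomial_shifted[of _ n] assms by (intro sum.cong refl) (simp add: c_def)
  also have "\<dots> = 1"
    using assms by simp
  finally show ?thesis .
qed

text \<open>The integrands agree pointwise once the Gaussian density is absorbed, so only
  measurability of \<open>f\<close> is assumed: \<open>integral_density\<close> respects the default
  value 0 of non-integrable functions.\<close>

lemma berezin_eq:
  assumes "n \<ge> 1" and [measurable]: "f \<in> borel_measurable lebesgue"
  shows "berezin n f z = (LINT w|lebesgue. berezin_weight n (w - z) *\<^sub>R f w)"
proof -
  let ?k = "normalized_fock_kernel n z"
  have "continuous_on UNIV ?k"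
    unfolding normalized_fock_kernel_def[abs_def] fock_kernel_def gen_laguerre_def divide_inverse
    by (intro continuous_intros)
  then have k [measurable]: "?k \<in> borel_measurable lebesgue"
    by (intro measurable_completion) (simp add: borel_measurable_continuous_onI)
  have [measurable]: "cnj \<in> borel_measurable borel"
    by (intro borel_measurable_continuous_onI continuous_intros)
  have "(\<lambda>w. f w * ?k w * cnj (?k w)) \<in> borel_measurable lebesgue"
    by measurable
  moreover have "continuous_on UNIV (\<lambda>z::complex. exp (- (cmod z)\<^sup>2) / pi)"
    by (intro continuous_intros) simp
  then have "(\<lambda>z::complex. exp (- (cmod z)\<^sup>2) / pi) \<in> borel_measurable lebesgue"
    by (intro measurable_completion) (simp add: borel_measurable_continuous_onI)
  moreover have "(exp (- (cmod w)\<^sup>2) / pi) *\<^sub>R (?k w * cnj (?k w)) = of_real (berezin_weight n (w - z))" for w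
  proof -
    define L where "L = gen_laguerre 1 (n - 1) ((cmod (w - z))\<^sup>2)"
    have "exp (z * cnj z) = of_real (exp ((cmod z)\<^sup>2))"
      by (metis complex_norm_square exp_of_real)
    then have diag: "fock_kernel n z z = of_real (real n * exp ((cmod z)\<^sup>2))"
      by (simp add: fock_kernel_def gen_laguerre_1_at_0[OF assms(1), simplified])
    have "cmod (?k w) = \<bar>L\<bar> * exp (Re (w * cnj z)) / sqrt (real n * exp ((cmod z)\<^sup>2))"
      unfolding normalized_fock_kernel_def diag
      by (simp add: fock_kernel_def norm_mult norm_divide L_def)
    then have "(cmod (?k w))\<^sup>2 = L\<^sup>2 * (exp (Re (w * cnj z)))\<^sup>2 / (real n * exp ((cmod z)\<^sup>2))"
      by (simp add: power_mult_distrib power_divide)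
    then have "exp (- (cmod w)\<^sup>2) / pi * (cmod (?k w))\<^sup>2 =
        L\<^sup>2 * (exp (- (cmod w)\<^sup>2) * (exp (Re (w * cnj z)))\<^sup>2 / exp ((cmod z)\<^sup>2)) / (real n * pi)"
      by (simp add: field_simps)
    also have "exp (- (cmod w)\<^sup>2) * (exp t)\<^sup>2 / exp ((cmod z)\<^sup>2) =
        exp (- (cmod w)\<^sup>2 + 2 * t - (cmod z)\<^sup>2)" for t
      by (simp add: exp_add exp_diff exp_double exp_minus divide_inverse)
    also have "- (cmod w)\<^sup>2 + 2 * Re (w * cnj z) - (cmod z)\<^sup>2 = - (cmod (w - z))\<^sup>2"
      unfolding cmod_power2 by (simp add: power2_eq_square algebra_simps)
    finally have "exp (- (cmod w)\<^sup>2) / pi * (cmod (?k w))\<^sup>2 = berezin_weight n (w - z)"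
      by (simp add: berezin_weight_def L_def)
    then show ?thesis
      by (simp only: complex_norm_square[symmetric] scaleR_conv_of_real of_real_mult[symmetric])
  qed
  then have "(exp (- (cmod w)\<^sup>2) / pi) *\<^sub>R (f w * ?k w * cnj (?k w)) =
      berezin_weight n (w - z) *\<^sub>R f w" for w
    by (metis (no_types, lifting) mult.assoc mult_scaleR_right mult.commute scaleR_conv_of_real)
  ultimately show ?thesis
    unfolding berezin_def gaussian_inner_def gaussian_measure_def
    by (subst integral_density) simp_all
qed

section \<open>Fixed points of convolutions\<close>

lemma integral_lborel_translate:
  fixes t :: "'a::euclidean_space" and g :: "'a \<Rightarrow> 'b::{banach, second_countable_topology}"
  assumes [measurable]: "g \<in> borel_measurable borel"
  shows "(LINT x|lborel. g (t + x)) = (LINT x|lborel. g x)"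
  by (subst (2) lborel_distr_plus[of t, symmetric]) (simp add: integral_distr)

lemma integrable_lborel_translate:
  fixes t :: "'a::euclidean_space" and g :: "'a \<Rightarrow> 'b::{banach, second_countable_topology}"
  assumes "integrable lborel g"
  shows "integrable lborel (\<lambda>x. g (t + x))"
proof -
  have "g \<in> borel_measurable borel"
    using borel_measurable_integrable[OF assms] by simp
  then show ?thesis
    using assms integrable_distr_eq[of "(+) t" lborel borel g] by (simp add: lborel_distr_plus)
qed

text \<open>At a point where \<open>g = f (\<cdot> + a) - f\<close> nearly attains its supremum \<open>M\<close>, averaging forces
  \<open>g\<close> to be nearly \<open>M\<close> also \<open>a\<close> further on, hence along arbitrarily many steps of length \<open>a\<close>;
  these increments add up, so \<open>M > 0\<close> would contradict the boundedness of \<open>f\<close>.\<close>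

lemma choquet_deny_local:
  fixes \<phi> f :: "'a::euclidean_space \<Rightarrow> real"
  assumes \<phi>: "has_bochner_integral lborel \<phi> 1" "\<And>w. \<phi> w \<ge> 0"
    and m: "m > 0" "\<And>w. norm w < \<rho> \<Longrightarrow> m \<le> \<phi> w"
    and bdd: "\<And>z. \<bar>f z\<bar> \<le> C"
    and uc: "uniformly_continuous_on UNIV f"
    and inv: "\<And>z. f z = (LINT w|lborel. \<phi> w * f (z + w))"
    and a: "norm a < \<rho> / 2"
  shows "f (z + a) \<le> f z"
proof (rule ccontr)
  assume neg: "\<not> f (z + a) \<le> f z"
  have [measurable]: "f \<in> borel_measurable borel"
    using uc by (intro borel_measurable_continuous_onI uniformly_continuous_imp_continuous)
  have \<phi>_int [simp]: "integrable lborel \<phi>" "(LINT w|lborel. \<phi> w) = 1"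
    using \<phi>(1) by (auto simp: has_bochner_integral_iff)
  have [measurable]: "\<phi> \<in> borel_measurable borel"
    using borel_measurable_integrable[OF \<phi>_int(1)] by simp
  have f_int: "integrable lborel (\<lambda>w. \<phi> w * f (x + w))" for x
  proof (rule Bochner_Integration.integrable_bound)
    show "integrable lborel (\<lambda>w. C * \<phi> w)" by simp
    show "AE w in lborel. norm (\<phi> w * f (x + w)) \<le> norm (C * \<phi> w)"
      using bdd \<phi>(2) by (auto simp: abs_mult mult.commute[of C] intro!: AE_I2 mult_left_mono order_trans[OF bdd])
  qed simp
  define g where "g x = f (x + a) - f x" for x
  have [measurable]: "g \<in> borel_measurable borel" unfolding g_def by simp
  define M where "M = (SUP x. g x)"
  have "bdd_above (range g)"
  proof (rule bdd_aboveI2)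
    show "g x \<le> 2 * C" for x
      using bdd[of x] bdd[of "x + a"] by (simp add: g_def abs_le_iff)
  qed
  then have le_M: "g x \<le> M" for x
    unfolding M_def by (rule cSUP_upper[OF UNIV_I])
  have "M > 0"
    using neg le_M[of z] by (simp add: g_def)
  \<comment> \<open>Mass 1 lets the constant \<open>M\<close> pass through the average, so the
    nonnegative defect \<open>M - g\<close> is again a fixed point.\<close>
  have g_inv: "has_bochner_integral lborel (\<lambda>w. \<phi> w * (M - g (x + w))) (M - g x)" for x
  proof -
    have "has_bochner_integral lborel
        (\<lambda>w. M * \<phi> w - (\<phi> w * f ((x + a) + w) - \<phi> w * f (x + w))) (M * 1 - (f (x + a) - f x))"
      using f_int by (simp add: has_bochner_integral_iff flip: inv)
    then show ?thesis by (simp add: g_def algebra_simps)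
  qed
  have step: "\<exists>\<delta>>0. \<forall>x. g x > M - \<delta> \<longrightarrow> g (x + a) > M - \<epsilon>" if "\<epsilon> > 0" for \<epsilon>
  proof -
    obtain r where r: "r > 0" "\<And>x y. dist y x < r \<Longrightarrow> dist (f y) (f x) < \<epsilon> / 4"
      using uc[unfolded uniformly_continuous_on_def, rule_format, of "\<epsilon> / 4"] \<open>\<epsilon> > 0\<close> by auto
    \<comment> \<open>On \<open>ball a s\<close> both values of \<open>f\<close> in
      \<open>g (x + w)\<close> differ from those in \<open>g (x + a)\<close> by less than
      \<open>\<epsilon> / 4\<close>. The cap \<open>\<rho> / 2\<close>, with
      \<open>norm a < \<rho> / 2\<close>, keeps the ball where \<open>\<phi>\<close> is at least
      \<open>m\<close>.\<close>
    define s where "s = min r (\<rho> / 2)"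
    have "s > 0" using r(1) a norm_ge_zero[of a] by (simp add: s_def del: norm_ge_zero)
    define c where "c = measure lborel (ball a s)"
    have "c > 0" using \<open>s > 0\<close> by (simp add: c_def content_ball)
    \<comment> \<open>If \<open>g (x + a)\<close> were at most \<open>M - \<epsilon>\<close>, the
      defect would be at least \<open>\<epsilon> / 2\<close> on the ball, and its average at least
      this product of volume, weight and defect.\<close>
    define \<delta> where "\<delta> = c * (m * (\<epsilon> / 2))"
    have "\<delta> > 0" using \<open>c > 0\<close> m(1) \<open>\<epsilon> > 0\<close> by (simp add: \<delta>_def)
    moreover have "g (x + a) > M - \<epsilon>" if x: "g x > M - \<delta>" for x
    proof (rule ccontr)
      assume "\<not> g (x + a) > M - \<epsilon>"
      have low: "has_bochner_integral lborel (\<lambda>w. indicator (ball a s) w *\<^sub>R (m * (\<epsilon> / 2))) \<delta>"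
        unfolding \<delta>_def c_def
        using has_bochner_integral_indicator[of "ball a s" lborel "m * (\<epsilon> / 2)"] \<open>s > 0\<close>
        by (simp add: emeasure_ball)
      have "indicator (ball a s) w *\<^sub>R (m * (\<epsilon> / 2)) \<le> \<phi> w * (M - g (x + w))" for w
      proof (cases "w \<in> ball a s")
        case True
        then have aw: "norm (a - w) < r" "norm (a - w) < \<rho> / 2"
          by (auto simp: s_def dist_norm)
        have "norm w < \<rho>"
          using norm_triangle_ineq4[of a "a - w"] a aw(2) by simp
        then have "m \<le> \<phi> w" by (rule m(2))
        have "dist (x + w + a) (x + a + a) < r" "dist (x + w) (x + a) < r"
          using aw(1) by (simp_all add: dist_norm norm_minus_commute)
        from this[THEN r(2)] have "dist (f (x + w + a)) (f (x + a + a)) < \<epsilon> / 4"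
            "dist (f (x + w)) (f (x + a)) < \<epsilon> / 4"
          by simp_all
        then have "g (x + w) \<le> g (x + a) + \<epsilon> / 2"
          unfolding g_def dist_real_def by linarith
        then have "\<epsilon> / 2 \<le> M - g (x + w)"
          using \<open>\<not> g (x + a) > M - \<epsilon>\<close> by simp
        then show ?thesis
          using True mult_mono[OF \<open>m \<le> \<phi> w\<close>, of "\<epsilon> / 2" "M - g (x + w)"] \<open>\<epsilon> > 0\<close> \<phi>(2)[of w] by simp
      qed (use \<phi>(2) le_M in \<open>auto simp: mult_nonneg_nonneg\<close>)
      with low g_inv[of x] have "\<delta> \<le> M - g x"
        by (metis (no_types, lifting) has_bochner_integral_iff integral_mono)
      then show False using x by simp
    qed
    ultimately show ?thesis by blast
  qed
  have chain: "\<exists>\<delta>>0. \<forall>x. g x > M - \<delta> \<longrightarrow> (\<forall>k<N. g (x + real k *\<^sub>R a) > M - M / 2)" for N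
  proof -
    \<comment> \<open>Tolerances are chosen backwards: the last step fixes \<open>\<delta>\<close>,
      and the induction hypothesis tells how close to \<open>M\<close> the start must be.\<close>
    have far: "\<exists>\<delta>>0. \<forall>x. g x > M - \<delta> \<longrightarrow> g (x + real k *\<^sub>R a) > M - \<epsilon>" if "\<epsilon> > 0" for k \<epsilon>
      using that
    proof (induction k arbitrary: \<epsilon>)
      case 0
      then show ?case by auto
    next
      case (Suc k)
      obtain \<delta> where \<delta>: "\<delta> > 0" "\<And>x. g x > M - \<delta> \<Longrightarrow> g (x + a) > M - \<epsilon>"
        using step[OF Suc.prems] by blast
      obtain \<eta> where \<eta>: "\<eta> > 0" "\<And>x. g x > M - \<eta> \<Longrightarrow> g (x + real k *\<^sub>R a) > M - \<delta>"
        using Suc.IH[OF \<delta>(1)] by blast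
      have "g (x + real (Suc k) *\<^sub>R a) > M - \<epsilon>" if "g x > M - \<eta>" for x
        using \<delta>(2)[OF \<eta>(2)[OF that]] by (simp add: algebra_simps)
      then show ?case using \<eta>(1) by blast
    qed
    show ?thesis
    proof (induction N)
      case 0
      then show ?case by (auto intro: exI[of _ 1])
    next
      case (Suc N)
      obtain \<delta> where "\<delta> > 0" "\<And>x. g x > M - \<delta> \<Longrightarrow> (\<forall>k<N. g (x + real k *\<^sub>R a) > M - M / 2)"
        using Suc.IH by blast
      moreover obtain \<eta> where "\<eta> > 0" "\<And>x. g x > M - \<eta> \<Longrightarrow> g (x + real N *\<^sub>R a) > M - M / 2"
        using far[of "M / 2" N] \<open>M > 0\<close> by auto
      ultimately show ?case
        by (intro exI[of _ "min \<delta> \<eta>"]) (auto simp: less_Suc_eq)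
    qed
  qed
  \<comment> \<open>\<open>N\<close> increments above \<open>M / 2\<close> exceed the largest
    possible oscillation \<open>2 * C\<close> of \<open>f\<close>.\<close>
  obtain N where N: "2 * C < real N * (M / 2)"
    using reals_Archimedean3[OF half_gt_zero[OF \<open>M > 0\<close>]] by blast
  obtain \<delta> where "\<delta> > 0" and \<delta>: "\<And>x k. g x > M - \<delta> \<Longrightarrow> k < N \<Longrightarrow> g (x + real k *\<^sub>R a) > M - M / 2"
    using chain[of N] by blast
  obtain x where x: "g x > M - \<delta>"
    using less_cSUP_iff[OF _ \<open>bdd_above (range g)\<close>, of "M - \<delta>"] \<open>\<delta> > 0\<close> unfolding M_def by auto
  have "real N * (M / 2) = (\<Sum>k<N. M / 2)" by simp
  also have "\<dots> \<le> (\<Sum>k<N. g (x + real k *\<^sub>R a))"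
    using \<delta>[OF x] by (intro sum_mono) (simp add: less_imp_le)
  also have "\<dots> = (\<Sum>k<N. f (x + real (Suc k) *\<^sub>R a) - f (x + real k *\<^sub>R a))"
    by (simp add: g_def algebra_simps)
  also have "\<dots> = f (x + real N *\<^sub>R a) - f x"
    by (simp add: sum_lessThan_telescope[of "\<lambda>k. f (x + real k *\<^sub>R a)"] del: of_nat_Suc)
  also have "\<dots> \<le> 2 * C"
    using bdd[of x] bdd[of "x + real N *\<^sub>R a"] by (simp add: abs_le_iff)
  finally show False using N by simp
qed

text \<open>Continuity gives a ball on which \<open>\<phi>\<close> is at least
  \<open>\<phi> 0 / 2\<close>. The local lemma for \<open>a\<close> and for \<open>- a\<close> then
  makes \<open>f\<close> invariant under short translations, and \<open>x\<close> is reached from 0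
  by \<open>N\<close> equal short ones.\<close>

theorem choquet_deny:
  fixes \<phi> f :: "'a::euclidean_space \<Rightarrow> real"
  assumes \<phi>: "has_bochner_integral lborel \<phi> 1" "\<And>w. \<phi> w \<ge> 0" "isCont \<phi> 0" "\<phi> 0 > 0"
    and bdd: "\<And>z. \<bar>f z\<bar> \<le> C"
    and uc: "uniformly_continuous_on UNIV f"
    and inv: "\<And>z. f z = (LINT w|lborel. \<phi> w * f (z + w))"
  shows "f x = f 0"
proof -
  obtain \<rho> where \<rho>: "\<rho> > 0" "\<And>w. norm w < \<rho> \<Longrightarrow> dist (\<phi> w) (\<phi> 0) < \<phi> 0 / 2"
    using \<phi>(3)[unfolded continuous_at_eps_delta, rule_format, of "\<phi> 0 / 2"] \<phi>(4) by auto
  have "\<phi> 0 / 2 \<le> \<phi> w" if "norm w < \<rho>" for w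
    using \<rho>(2)[OF that] by (simp add: dist_real_def abs_if split: if_splits)
  note le = choquet_deny_local[where \<rho> = \<rho>, OF \<phi>(1,2) _ this bdd uc inv]
  have eq: "f (z + a) = f z" if "norm a < \<rho> / 2" for z a
    using le[where a = a and z = z] le[where a = "- a" and z = "z + a"] that \<phi>(4) by simp
  obtain N where N: "norm x < real N * (\<rho> / 2)"
    using reals_Archimedean3[OF half_gt_zero[OF \<rho>(1)]] by blast
  then have "N > 0" by (cases "N = 0") auto
  have "f (real k *\<^sub>R (x /\<^sub>R real N)) = f 0" for k
  proof (induction k)
    case (Suc k)
    have "norm (x /\<^sub>R real N) < \<rho> / 2"
      using N \<open>N > 0\<close> by (simp add: field_simps)
    from eq[OF this, of "real k *\<^sub>R (x /\<^sub>R real N)"] Suc show ?case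
      by (simp add: algebra_simps)
  qed simp
  from this[of N] \<open>N > 0\<close> show ?thesis by simp
qed

text \<open>Scheffe's lemma applies: translates converge pointwise by continuity, and their norms
  all agree by translation invariance.\<close>

lemma tendsto_L1_translation:
  fixes \<phi> :: "'a::euclidean_space \<Rightarrow> real"
  assumes "continuous_on UNIV \<phi>" "integrable lborel \<phi>"
  shows "((\<lambda>h. LINT w|lborel. \<bar>\<phi> (w - h) - \<phi> w\<bar>) \<longlongrightarrow> 0) (at 0)"
proof (subst tendsto_at_iff_sequentially, intro allI impI)
  fix X :: "nat \<Rightarrow> 'a" assume X: "X \<longlonglongrightarrow> 0"
  have [measurable]: "\<phi> \<in> borel_measurable borel"
    using assms(1) by (rule borel_measurable_continuous_onI)
  have int: "integrable lborel (\<lambda>w. \<phi> (w - h))" for h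
    using integrable_lborel_translate[OF assms(2), of "- h"] by simp
  have "(\<lambda>n. \<integral>\<^sup>+w. norm (\<phi> (w - X n) - \<phi> w) \<partial>lborel) \<longlonglongrightarrow> 0"
  proof (rule Scheffe_lemma2)
    show "AE w in lborel. (\<lambda>n. \<phi> (w - X n)) \<longlonglongrightarrow> \<phi> w"
    proof (rule AE_I2)
      fix w
      have "(\<lambda>n. w - X n) \<longlonglongrightarrow> w"
        using tendsto_diff[OF tendsto_const X] by simp
      then show "(\<lambda>n. \<phi> (w - X n)) \<longlonglongrightarrow> \<phi> w"
        using assms(1) by (intro isCont_tendsto_compose[of _ \<phi>]) (simp add: continuous_on_eq_continuous_at)
    qed
    show "(\<integral>\<^sup>+w. norm (\<phi> (w - X n)) \<partial>lborel) \<le> (\<integral>\<^sup>+w. norm (\<phi> w) \<partial>lborel)" for n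
      using nn_integral_lborel_translate[of "\<lambda>w. ennreal (norm (\<phi> w))" "- X n"] by simp
  qed (use assms in auto)
  also have "(\<lambda>n. \<integral>\<^sup>+w. norm (\<phi> (w - X n) - \<phi> w) \<partial>lborel) =
      (\<lambda>n. ennreal (LINT w|lborel. \<bar>\<phi> (w - X n) - \<phi> w\<bar>))"
    by (subst nn_integral_eq_integral) (auto intro!: int assms)
  finally show "((\<lambda>h. LINT w|lborel. \<bar>\<phi> (w - h) - \<phi> w\<bar>) \<circ> X) \<longlonglongrightarrow> 0"
    by (simp add: o_def tendsto_ennreal_iff[of _ _ 0, simplified])
qed

text \<open>Two values differ by at most \<open>C\<close> times the L1 distance of two translates of
  \<open>\<phi>\<close>, which depends only on \<open>y - x\<close>.\<close>

lemma uniformly_continuous_convolution: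
  fixes \<phi> :: "'a::euclidean_space \<Rightarrow> real" and f :: "'a \<Rightarrow> 'b::{banach, second_countable_topology}"
  assumes \<phi>: "continuous_on UNIV \<phi>" "integrable lborel \<phi>"
    and f [measurable]: "f \<in> borel_measurable lebesgue" and bdd: "\<And>w. norm (f w) \<le> C"
  shows "uniformly_continuous_on UNIV (\<lambda>z. LINT w|lebesgue. \<phi> (w - z) *\<^sub>R f w)"
  unfolding uniformly_continuous_on_def
proof (intro allI impI)
  fix \<epsilon> :: real assume "\<epsilon> > 0"
  have C: "C \<ge> 0" using norm_ge_zero bdd by (rule order_trans)
  have [measurable]: "\<phi> \<in> borel_measurable borel"
    using \<phi>(1) by (rule borel_measurable_continuous_onI)
  have int: "integrable lborel (\<lambda>w. \<phi> (w - h))" for h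
    using integrable_lborel_translate[OF \<phi>(2), of "- h"] by simp
  have meas: "(\<lambda>w. \<phi> (w - h)) \<in> borel_measurable lebesgue" for h
    by (rule measurable_completion) simp
  have int_conv: "integrable lebesgue (\<lambda>w. \<phi> (w - z) *\<^sub>R f w)" for z
  proof (rule Bochner_Integration.integrable_bound)
    show "integrable lebesgue (\<lambda>w. C * \<phi> (w - z))"
      using int by (subst integrable_completion) auto
    show "AE w in lebesgue. norm (\<phi> (w - z) *\<^sub>R f w) \<le> norm (C * \<phi> (w - z))"
      using C bdd by (auto simp: abs_mult mult.commute[of C] intro!: AE_I2 mult_left_mono)
  qed (use meas f in measurable)
  define T where "T h = (LINT w|lborel. \<bar>\<phi> (w - h) - \<phi> w\<bar>)" for h
  have "T \<midarrow>0\<rightarrow> 0"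
    using tendsto_L1_translation[OF \<phi>] by (simp add: T_def[abs_def])
  \<comment> \<open>Dividing by \<open>C + 1\<close> covers \<open>C = 0\<close>. The limit says
    nothing at \<open>h = 0\<close>, so \<open>y = x\<close> is split off below.\<close>
  then obtain d where d: "d > 0" "\<And>h. h \<noteq> 0 \<Longrightarrow> norm h < d \<Longrightarrow> \<bar>T h\<bar> < \<epsilon> / (C + 1)"
    using LIM_D[of T 0 0 "\<epsilon> / (C + 1)"] \<open>\<epsilon> > 0\<close> C by auto
  have "dist (LINT w|lebesgue. \<phi> (w - y) *\<^sub>R f w) (LINT w|lebesgue. \<phi> (w - x) *\<^sub>R f w) < \<epsilon>"
    if yx: "dist y x < d" for x y
  proof (cases "y = x")
    case False
    have "dist (LINT w|lebesgue. \<phi> (w - y) *\<^sub>R f w) (LINT w|lebesgue. \<phi> (w - x) *\<^sub>R f w) =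
        norm (LINT w|lebesgue. \<phi> (w - y) *\<^sub>R f w - \<phi> (w - x) *\<^sub>R f w)"
      by (simp add: dist_norm int_conv)
    also have "\<dots> \<le> (LINT w|lebesgue. C * \<bar>\<phi> (w - y) - \<phi> (w - x)\<bar>)"
    proof (rule Bochner_Integration.integral_norm_bound_integral)
      show "integrable lebesgue (\<lambda>w. C * \<bar>\<phi> (w - y) - \<phi> (w - x)\<bar>)"
        using int by (subst integrable_completion) auto
      show "norm (\<phi> (w - y) *\<^sub>R f w - \<phi> (w - x) *\<^sub>R f w) \<le> C * \<bar>\<phi> (w - y) - \<phi> (w - x)\<bar>" for w
        using bdd[of w] by (simp add: mult.commute[of C] mult_left_mono flip: scaleR_diff_left)
    qed (use int_conv in simp)
    also have "\<dots> = C * (LINT w|lborel. \<bar>\<phi> (w - y) - \<phi> (w - x)\<bar>)"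
      by (subst integral_completion) simp_all
    also have "(LINT w|lborel. \<bar>\<phi> (w - y) - \<phi> (w - x)\<bar>) = T (y - x)"
      using integral_lborel_translate[of "\<lambda>w. \<bar>\<phi> (w - y) - \<phi> (w - x)\<bar>" x]
      by (simp add: T_def algebra_simps)
    also have "C * T (y - x) \<le> C * (\<epsilon> / (C + 1))"
      using d(2)[of "y - x"] yx False C by (intro mult_left_mono) (auto simp: dist_norm)
    also have "\<dots> < \<epsilon>"
      using C \<open>\<epsilon> > 0\<close> by (simp add: field_simps)
    finally show ?thesis .
  qed (use \<open>\<epsilon> > 0\<close> in simp)
  then show "\<exists>d>0. \<forall>x\<in>UNIV. \<forall>y\<in>UNIV. dist y x < d \<longrightarrow>
      dist (LINT w|lebesgue. \<phi> (w - y) *\<^sub>R f w) (LINT w|lebesgue. \<phi> (w - x) *\<^sub>R f w) < \<epsilon>"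
    using d(1) by blast
qed

section \<open>Mean values of harmonic functions\<close>

text \<open>The circle means \<open>m\<close> over radius \<open>r\<close> satisfy the radial Laplace equation \<open>(r m')' = 0\<close>:
  the radial second derivative is minus the tangential one up to a first-order term, and these
  combine to a \<open>t\<close>-derivative, which integrates to zero over the circle.\<close>

lemma harmonic_circle_integral:
  assumes "h harmonic_on UNIV"
  shows "integral {0..2 * pi} (\<lambda>t. h (z + w * cis t)) = (2 * pi) *\<^sub>R h z"
proof -
  obtain h' :: "complex \<Rightarrow> complex \<Rightarrow>\<^sub>L complex" and h'' :: "complex \<Rightarrow> complex \<Rightarrow>\<^sub>L complex \<Rightarrow>\<^sub>L complex"
    where h': "\<And>x. (h has_derivative blinfun_apply (h' x)) (at x)"
      and h'': "\<And>x. (h' has_derivative blinfun_apply (h'' x)) (at x)"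
      and cont'': "continuous_on UNIV h''"
      and lap: "\<And>x. h'' x 1 1 + h'' x \<i> \<i> = 0"
    using assms unfolding harmonic_on_def by auto
  have cont: "continuous_on S h" and cont': "continuous_on S h'" for S
    using h' h'' by (meson continuous_at_imp_continuous_on has_derivative_continuous)+
  note [continuous_intros] = continuous_on_compose2[OF cont] continuous_on_compose2[OF cont']
    continuous_on_compose2[OF cont'']
  define e where "e t = w * cis t" for t
  define p where "p r t = z + r *\<^sub>R e t" for r t
  have cont_p: "continuous_on S (\<lambda>(r, t). p r t)" and cont_e: "continuous_on S (\<lambda>(r, t). e t)"
    for S :: "(real \<times> real) set"
    unfolding p_def e_def split_beta by (intro continuous_intros)+
  note [continuous_intros] = cont_p[unfolded split_beta] cont_e[unfolded split_beta]
  have e_der: "(e has_vector_derivative \<i> * e t) (at t)" for t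
    unfolding e_def[abs_def] has_vector_derivative_def
    by (auto intro!: derivative_eq_intros simp: scaleR_conv_of_real algebra_simps)
  have p_der_r: "((\<lambda>r. p r t) has_vector_derivative e t) (at r)" for r t
    unfolding p_def by (auto intro!: derivative_eq_intros)
  have p_der_t: "((\<lambda>t. p r t) has_vector_derivative r *\<^sub>R (\<i> * e t)) (at t)" for r t
    unfolding p_def by (auto intro!: derivative_eq_intros e_der)
  note chain = vector_derivative_diff_chain_within[where S = UNIV, unfolded o_def, OF _ has_derivative_at_withinI]
  define dr where "dr r t = h' (p r t) (e t)" for r t
  \<comment> \<open>\<open>D\<close> is the \<open>r\<close>-derivative of \<open>r\<close> times
    the radial derivative \<open>dr\<close>.\<close>
  define D where "D r t = dr r t + r *\<^sub>R h'' (p r t) (e t) (e t)" for r t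
  have h_der: "((\<lambda>r. h (p r t)) has_vector_derivative dr r t) (at r)" for r t
    using chain[OF p_der_r h'] by (simp add: dr_def)
  have dr_der: "((\<lambda>r. r *\<^sub>R dr r t) has_vector_derivative D r t) (at r)" for r t
  proof -
    have "((\<lambda>r. h' (p r t) (e t)) has_vector_derivative h' (p r t) 0 + h'' (p r t) (e t) (e t)) (at r)"
      by (intro bounded_bilinear.has_vector_derivative[OF bounded_bilinear_blinfun_apply]
          chain[OF p_der_r h''] has_vector_derivative_const)
    from bounded_bilinear.has_vector_derivative[OF bounded_bilinear_scaleR has_vector_derivative_id this]
    show ?thesis by (simp add: D_def dr_def add.commute)
  qed
  \<comment> \<open>The pair \<open>v\<close>, \<open>\<i> * v\<close> is the basis
    \<open>1\<close>, \<open>\<i>\<close> rotated and scaled, so the Laplacian in it is a multiple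
    of the usual one; the mixed terms cancel.\<close>
  have trace: "h'' x v v = - h'' x (\<i> * v) (\<i> * v)" for x v
  proof -
    have v: "v = Re v *\<^sub>R 1 + Im v *\<^sub>R \<i>" "\<i> * v = (- Im v) *\<^sub>R 1 + Re v *\<^sub>R \<i>"
      by (simp_all add: complex_eq_iff)
    have "h'' x v v + h'' x (\<i> * v) (\<i> * v) = ((Re v)\<^sup>2 + (Im v)\<^sup>2) *\<^sub>R (h'' x 1 1 + h'' x \<i> \<i>)"
      unfolding v(2) by (subst (1 2) v(1))
        (simp only: blinfun.bilinear_simps scaleR_add_right scaleR_add_left scaleR_scaleR,
          simp add: scaleR_conv_of_real power2_eq_square algebra_simps)
    then show ?thesis by (simp add: lap eq_neg_iff_add_eq_0)
  qed
  have D_integral: "integral {0..2 * pi} (D r) = 0" for r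
  proof -
    \<comment> \<open>The tangential derivative without its factor \<open>r\<close> has
      \<open>t\<close>-derivative \<open>- D r t\<close>; being periodic in \<open>t\<close>, it has
      equal values at 0 and \<open>2 * pi\<close>.\<close>
    have "((\<lambda>t. h' (p r t) (\<i> * e t)) has_vector_derivative
        h' (p r t) (\<i> * (\<i> * e t)) + h'' (p r t) (r *\<^sub>R (\<i> * e t)) (\<i> * e t)) (at t)" for t
      by (intro bounded_bilinear.has_vector_derivative[OF bounded_bilinear_blinfun_apply]
          chain[OF p_der_t h''] has_vector_derivative_mult_right e_der)
    moreover have "h' (p r t) (\<i> * (\<i> * e t)) + h'' (p r t) (r *\<^sub>R (\<i> * e t)) (\<i> * e t) = - D r t" for t
      using trace[of "p r t" "e t"]
      by (simp add: D_def dr_def blinfun.bilinear_simps flip: mult.assoc)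
    ultimately have "((\<lambda>t. - D r t) has_integral
        h' (p r (2 * pi)) (\<i> * e (2 * pi)) - h' (p r 0) (\<i> * e 0)) {0..2 * pi}"
      by (intro fundamental_theorem_of_calculus) (auto intro: has_vector_derivative_at_within)
    then have "((\<lambda>t. - D r t) has_integral 0) {0..2 * pi}"
      by (simp add: p_def e_def)
    then show ?thesis
      using has_integral_neg[of "\<lambda>t. - D r t"] by (metis (no_types, lifting) add.inverse_inverse add.inverse_neutral ext integral_unique)
  qed
  have leibniz: "((\<lambda>r. integral (cbox 0 (2 * pi)) (q r)) has_vector_derivative
      integral (cbox 0 (2 * pi)) (q' r)) (at r)"
    if "\<And>r t. ((\<lambda>r. q r t) has_vector_derivative q' r t) (at r)"
      "continuous_on UNIV (\<lambda>(r, t). q r t)" "continuous_on UNIV (\<lambda>(r, t). q' r t)"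
    for q q' :: "real \<Rightarrow> real \<Rightarrow> complex" and r
  proof (rule leibniz_rule_vector_derivative[of UNIV])
    fix r
    have "continuous_on (cbox 0 (2 * pi)) (\<lambda>t. (\<lambda>(r, t). q r t) (r, t))"
      by (rule continuous_on_compose2[OF that(2)]) (auto intro!: continuous_intros)
    then show "q r integrable_on cbox 0 (2 * pi)"
      by (intro integrable_continuous) simp
  qed (use that in \<open>auto intro: continuous_on_subset\<close>)
  have cont_dr: "continuous_on UNIV (\<lambda>(r, t). dr r t)"
    unfolding dr_def split_beta by (intro continuous_intros) auto
  have G: "((\<lambda>r. integral (cbox 0 (2 * pi)) (\<lambda>t. r *\<^sub>R dr r t)) has_vector_derivative 0) (at r)" for r
  proof -
    have "continuous_on UNIV (\<lambda>(r, t). r *\<^sub>R dr r t)" "continuous_on UNIV (\<lambda>(r, t). D r t)"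
      unfolding D_def dr_def split_beta by (intro continuous_intros; auto)+
    from leibniz[OF dr_der this, of r] show ?thesis
      using D_integral[of r] by simp
  qed
  \<comment> \<open>By \<open>G\<close>, \<open>r\<close> times this integral is constant, hence
    equal to its value 0 at \<open>r = 0\<close>; at \<open>r = 0\<close> itself \<open>D\<close>
    reduces to \<open>dr\<close>.\<close>
  have N: "integral {0..2 * pi} (dr r) = 0" for r
  proof (cases "r = 0")
    case True
    then show ?thesis using D_integral[of 0] by (simp add: D_def[abs_def] dr_def[abs_def])
  next
    case False
    obtain c where c: "\<And>r. integral (cbox 0 (2 * pi)) (\<lambda>t. r *\<^sub>R dr r t) = c"
      using has_vector_derivative_zero_constant[of UNIV, OF _ G] by auto
    from c[of r] c[of 0] False show ?thesis by simp
  qed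
  have "((\<lambda>r. integral (cbox 0 (2 * pi)) (\<lambda>t. h (p r t))) has_vector_derivative 0) (at r)" for r
  proof -
    have "continuous_on UNIV (\<lambda>(r, t). h (p r t))"
      unfolding split_beta by (intro continuous_intros) auto
    from leibniz[OF h_der this cont_dr, of r] show ?thesis
      using N[of r] by simp
  qed
  then obtain c where c: "\<And>r. integral (cbox 0 (2 * pi)) (\<lambda>t. h (p r t)) = c"
    using has_vector_derivative_zero_constant[of UNIV] by auto
  \<comment> \<open>The circle of radius factor 0 degenerates to the point \<open>z\<close>.\<close>
  from c[of 1] c[of 0] show ?thesis
    by (simp add: p_def e_def)
qed

lemma harmonic_imp_continuous:
  assumes "h harmonic_on S"
  shows "continuous_on S h"
  using assms unfolding harmonic_on_def
  by (meson continuous_at_imp_continuous_on has_derivative_continuous)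

lemma harmonic_const: "open S \<Longrightarrow> (\<lambda>_. c) harmonic_on S"
  unfolding harmonic_on_def
  by (intro conjI exI[of _ "\<lambda>_. 0"]) (auto simp: zero_blinfun.rep_eq)

text \<open>Integrate \<open>J\<close> over angles and the disc in both orders. Integrating over
  \<open>w\<close> first, every angle gives the same value by rotation invariance; integrating over
  \<open>t\<close> first gives circle means. The cutoff leaves a continuous integrand on a compact
  set, which justifies Fubini.\<close>

lemma harmonic_radial_mean_cball:
  assumes h: "h harmonic_on UNIV"
    and \<phi>: "continuous_on UNIV \<phi>" "\<And>u w. cmod u = 1 \<Longrightarrow> \<phi> (u * w) = (\<phi> w :: real)"
  shows "(LINT w|lborel. indicator (cball 0 R) w *\<^sub>R \<phi> w *\<^sub>R h (z + w)) =
    (LINT w|lborel. indicator (cball 0 R) w *\<^sub>R \<phi> w) *\<^sub>R h z"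
proof -
  note conth = harmonic_imp_continuous[OF h]
  have [measurable]: "h \<in> borel_measurable borel" "\<phi> \<in> borel_measurable borel"
    using conth \<phi>(1) by (auto intro: borel_measurable_continuous_onI)
  define F where "F w = indicator (cball 0 R) w *\<^sub>R \<phi> w *\<^sub>R h (z + w)" for w
  define J where "J t w = indicator ({0..2*pi} \<times> cball 0 R) (t, w) *\<^sub>R \<phi> w *\<^sub>R h (z + w * cis t)" for t w
  have "continuous_on UNIV (\<lambda>x::real \<times> complex. \<phi> (snd x) *\<^sub>R h (z + snd x * cis (fst x)))"
    by (intro continuous_intros continuous_on_compose2[OF conth] continuous_on_compose2[OF \<phi>(1)]) auto
  then have "integrable lborel
      (\<lambda>x. indicator ({0..2*pi} \<times> cball 0 R) x *\<^sub>R \<phi> (snd x) *\<^sub>R h (z + snd x * cis (fst x)))"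
    by (intro borel_integrable_compact compact_Times) (auto intro: continuous_on_subset)
  then have int: "integrable (lborel \<Otimes>\<^sub>M lborel) (\<lambda>(t, w). J t w)"
    by (simp add: J_def lborel_prod case_prod_beta')
  have J1: "J t w = indicator {0..2*pi} t *\<^sub>R F (cis t * w)" for t w
    by (simp add: J_def F_def \<phi>(2) norm_mult mult.commute[of w "cis t"] split: split_indicator)
  have J2: "J t w = (indicator (cball 0 R) w *\<^sub>R \<phi> w) *\<^sub>R (indicator {0..2*pi} t *\<^sub>R h (z + w * cis t))" for t w
    by (simp add: J_def indicator_times)
  have rot: "(LINT w|lborel. F (cis t * w)) = (LINT w|lborel. F w)" for t
  proof -
    have "orthogonal_transformation (\<lambda>w. cis t * w)"
      by (simp add: orthogonal_transformation norm_mult bounded_linear.linear bounded_linear_mult_right)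
    note distr = lborel_distr_orthogonal_transformation[OF this]
    have "(LINT w|lborel. F w) = (LINT w|distr lborel borel (\<lambda>w. cis t * w). F w)"
      by (simp add: distr)
    also have "\<dots> = (LINT w|lborel. F (cis t * w))"
    proof (rule integral_distr)
      have [measurable]: "cball 0 R \<in> sets (borel :: complex measure)" by simp
      show "F \<in> borel_measurable borel" unfolding F_def by measurable
    qed simp
    finally show ?thesis by simp
  qed
  have circle: "(LINT t|lborel. indicator {0..2*pi} t *\<^sub>R h (z + w * cis t)) = (2 * pi) *\<^sub>R h z" for w
  proof -
    have "continuous_on {0..2*pi} (\<lambda>t. h (z + w * cis t))"
      by (intro continuous_intros continuous_on_compose2[OF conth]) auto
    then have "set_integrable lborel {0..2*pi} (\<lambda>t. h (z + w * cis t))"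
      unfolding set_integrable_def by (rule borel_integrable_compact[OF compact_Icc])
    from set_borel_integral_eq_integral(2)[OF this] harmonic_circle_integral[OF h]
    show ?thesis by (simp add: set_lebesgue_integral_def)
  qed
  have "(2 * pi) *\<^sub>R (LINT w|lborel. F w) = (LINT t|lborel. LINT w|lborel. J t w)"
    unfolding J1 by (simp add: rot)
  also have "\<dots> = (LINT w|lborel. LINT t|lborel. J t w)"
    by (rule lborel_pair.Fubini_integral[OF int, symmetric])
  also have "\<dots> = (LINT w|lborel. (indicator (cball 0 R) w *\<^sub>R \<phi> w) *\<^sub>R ((2 * pi) *\<^sub>R h z))"
    unfolding J2 by (simp add: circle del: scaleR_scaleR)
  also have "\<dots> = (2 * pi) *\<^sub>R ((LINT w|lborel. indicator (cball 0 R) w *\<^sub>R \<phi> w) *\<^sub>R h z)"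
  proof (subst integral_scaleR_left)
    show "integrable lborel (\<lambda>w. indicator (cball 0 R) w *\<^sub>R \<phi> w)"
      by (intro borel_integrable_compact compact_cball continuous_on_subset[OF \<phi>(1)]) simp
  qed (simp add: mult_ac)
  finally show ?thesis
    unfolding scaleR_cancel_left F_def by simp
qed

lemma harmonic_radial_mean:
  assumes h: "h harmonic_on UNIV"
    and \<phi>: "continuous_on UNIV \<phi>" "\<And>u w. cmod u = 1 \<Longrightarrow> \<phi> (u * w) = (\<phi> w :: real)"
    and int: "integrable lborel \<phi>" "integrable lborel (\<lambda>w. \<phi> w *\<^sub>R h (z + w))"
  shows "(LINT w|lborel. \<phi> w *\<^sub>R h (z + w)) = (LINT w|lborel. \<phi> w) *\<^sub>R h z"
proof -
  have lim: "(\<lambda>k. LINT w|lborel. indicator (cball 0 (real k)) w *\<^sub>R g w) \<longlonglongrightarrow> (LINT w|lborel. g w)"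
    if g: "integrable lborel g" for g :: "complex \<Rightarrow> 'b::{banach, second_countable_topology}"
  proof (rule integral_dominated_convergence[where w = "\<lambda>w. norm (g w)"])
    have "\<forall>\<^sub>F k in sequentially. indicator (cball 0 (real k)) w *\<^sub>R g w = g w" for w
    proof -
      obtain k0 where "norm w \<le> real k0" using real_arch_simple by blast
      then show ?thesis
        by (intro eventually_sequentiallyI[of k0]) auto
    qed
    then show "AE w in lborel. (\<lambda>k. indicator (cball 0 (real k)) w *\<^sub>R g w) \<longlonglongrightarrow> g w"
      by (auto intro: tendsto_eventually)
  qed (use g in \<open>auto simp: indicator_def\<close>)
  have "(\<lambda>k. (LINT w|lborel. indicator (cball 0 (real k)) w *\<^sub>R \<phi> w) *\<^sub>R h z) \<longlonglongrightarrow> (LINT w|lborel. \<phi> w) *\<^sub>R h z"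
    by (intro tendsto_scaleR lim[OF int(1)] tendsto_const)
  then have "(\<lambda>k. LINT w|lborel. indicator (cball 0 (real k)) w *\<^sub>R \<phi> w *\<^sub>R h (z + w))
      \<longlonglongrightarrow> (LINT w|lborel. \<phi> w) *\<^sub>R h z"
    by (subst harmonic_radial_mean_cball[OF h \<phi>])
  with lim[OF int(2)] show ?thesis
    by (rule LIMSEQ_unique)
qed

section \<open>Fixed points of the Berezin transform\<close>

text \<open>For finite \<open>p\<close>, either the modulus is at most 1 or it is at most its
  \<open>p\<close>-th power. The exponent enters the theorem only through this splitting.\<close>

lemma Lp_fun_dominated:
  assumes "Lp_fun p M f" "p \<ge> 1"
  shows "\<exists>C k. integrable M k \<and> (AE x in M. cmod (f x) \<le> C + k x)"
proof (cases "p = \<infinity>")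
  case True
  then obtain C where "AE x in M. cmod (f x) \<le> C"
    using assms(1) by (auto simp: Lp_fun_def)
  then show ?thesis
    by (intro exI[of _ C] exI[of _ "\<lambda>_. 0"]) simp
next
  case False
  have "integrable M (\<lambda>x. cmod (f x) powr enn2real p)"
    using assms(1) False by (simp add: Lp_fun_def)
  moreover have "1 \<le> enn2real p"
    using assms(2) False enn2real_mono[of 1 p] by (simp add: top.not_eq_extremum)
  then have "cmod (f x) \<le> 1 + cmod (f x) powr enn2real p" for x
    using powr_mono[of 1 "enn2real p" "cmod (f x)"]
    by (cases "cmod (f x) \<le> 1") (simp_all add: add_increasing2)
  ultimately show ?thesis by auto
qed

text \<open>The constant part of the majorant is paired with the mass of \<open>\<phi>\<close>, the
  integrable part with the sup bound \<open>K\<close>; the resulting bound is uniform in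
  \<open>z\<close>.\<close>

lemma convolution_bounded:
  fixes \<phi> :: "'a::euclidean_space \<Rightarrow> real" and f :: "'a \<Rightarrow> 'b::{banach, second_countable_topology}"
  assumes \<phi>: "integrable lborel \<phi>" "\<And>w. 0 \<le> \<phi> w" "\<And>w. \<phi> w \<le> K"
    and [measurable]: "f \<in> borel_measurable lebesgue"
    and k: "integrable lebesgue k" "AE w in lebesgue. norm (f w) \<le> C + k w"
  shows "integrable lebesgue (\<lambda>w. \<phi> (w - z) *\<^sub>R f w)"
    and "norm (LINT w|lebesgue. \<phi> (w - z) *\<^sub>R f w) \<le>
      \<bar>C\<bar> * (LINT w|lborel. \<phi> w) + K * (LINT w|lebesgue. \<bar>k w\<bar>)"
proof -
  have \<phi>_meas [measurable]: "\<phi> \<in> borel_measurable borel"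
    using borel_measurable_integrable[OF \<phi>(1)] by simp
  have [measurable]: "(\<lambda>w. \<phi> (w - z)) \<in> borel_measurable lebesgue"
    by (rule measurable_completion) simp
  have \<phi>_int: "integrable lebesgue (\<lambda>w. \<phi> (w - z))"
    using integrable_lborel_translate[OF \<phi>(1), of "- z"] by (subst integrable_completion) simp_all
  have int: "integrable lebesgue (\<lambda>w. \<bar>C\<bar> * \<phi> (w - z) + K * \<bar>k w\<bar>)"
    using \<phi>_int k(1) by simp
  have le: "AE w in lebesgue. norm (\<phi> (w - z) *\<^sub>R f w) \<le> \<bar>C\<bar> * \<phi> (w - z) + K * \<bar>k w\<bar>"
    using k(2)
  proof eventually_elim
    case (elim w)
    have "norm (\<phi> (w - z) *\<^sub>R f w) \<le> \<phi> (w - z) * (\<bar>C\<bar> + \<bar>k w\<bar>)"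
      using elim \<phi>(2)[of "w - z"] by (auto intro!: mult_left_mono)
    also have "\<dots> \<le> \<bar>C\<bar> * \<phi> (w - z) + K * \<bar>k w\<bar>"
      using mult_right_mono[OF \<phi>(3)[of "w - z"] abs_ge_zero[of "k w"]] by (simp add: algebra_simps)
    finally show ?case .
  qed
  then show conv: "integrable lebesgue (\<lambda>w. \<phi> (w - z) *\<^sub>R f w)"
    by (intro Bochner_Integration.integrable_bound[OF int]) auto
  have "norm (LINT w|lebesgue. \<phi> (w - z) *\<^sub>R f w) \<le> (LINT w|lebesgue. \<bar>C\<bar> * \<phi> (w - z) + K * \<bar>k w\<bar>)"
    by (rule order_trans[OF integral_norm_bound]) (rule integral_mono_AE[OF integrable_norm[OF conv] int le])
  also have "\<dots> = \<bar>C\<bar> * (LINT w|lebesgue. \<phi> (w - z)) + K * (LINT w|lebesgue. \<bar>k w\<bar>)"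
    using \<phi>_int k(1) by simp
  also have "(LINT w|lebesgue. \<phi> (w - z)) = (LINT w|lborel. \<phi> w)"
    using integral_lborel_translate[of \<phi> "- z"] by (subst integral_completion) simp_all
  finally show "norm (LINT w|lebesgue. \<phi> (w - z) *\<^sub>R f w) \<le>
      \<bar>C\<bar> * (LINT w|lborel. \<phi> w) + K * (LINT w|lebesgue. \<bar>k w\<bar>)" .
qed

text \<open>Moving the translation from \<open>\<phi>\<close> to \<open>f\<close> relies on
  translation invariance of \<open>lborel\<close>, hence on a Borel measurable
  \<open>f\<close>.\<close>

lemma convolution_centered:
  fixes \<phi> :: "'a::euclidean_space \<Rightarrow> real" and f :: "'a \<Rightarrow> 'b::{banach, second_countable_topology}"
  assumes [measurable]: "\<phi> \<in> borel_measurable borel" "f \<in> borel_measurable borel"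
  shows "(LINT w|lebesgue. \<phi> (w - z) *\<^sub>R f w) = (LINT w|lborel. \<phi> w *\<^sub>R f (z + w))"
    and "integrable lebesgue (\<lambda>w. \<phi> (w - z) *\<^sub>R f w) \<Longrightarrow> integrable lborel (\<lambda>w. \<phi> w *\<^sub>R f (z + w))"
proof -
  show "(LINT w|lebesgue. \<phi> (w - z) *\<^sub>R f w) = (LINT w|lborel. \<phi> w *\<^sub>R f (z + w))"
    using integral_lborel_translate[of "\<lambda>w. \<phi> (w - z) *\<^sub>R f w" z]
    by (subst integral_completion) simp_all
  assume "integrable lebesgue (\<lambda>w. \<phi> (w - z) *\<^sub>R f w)"
  then have "integrable lborel (\<lambda>w. \<phi> (w - z) *\<^sub>R f w)"
    by (subst (asm) integrable_completion) simp_all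
  from integrable_lborel_translate[OF this, of z]
  show "integrable lborel (\<lambda>w. \<phi> w *\<^sub>R f (z + w))" by simp
qed

theorem theorem1:
  fixes n :: nat and p :: ennreal and f :: "complex \<Rightarrow> complex"
  assumes "n \<ge> 1" and "p \<ge> 1" and "Lp_fun p lebesgue f"
  shows "(AE z in lebesgue. berezin n f z = f z) \<longleftrightarrow>
         (\<exists>h. h harmonic_on UNIV \<and> (AE z in lebesgue. f z = h z))"
proof -
  let ?\<phi> = "berezin_weight n"
  have f_meas [measurable]: "f \<in> borel_measurable lebesgue"
    using assms(3) by (simp add: Lp_fun_def)
  have \<phi>_mass: "has_bochner_integral lborel ?\<phi> 1"
    by (rule has_bochner_integral_berezin_weight[OF assms(1)])
  then have \<phi>_int: "integrable lborel ?\<phi>" "(LINT w|lborel. ?\<phi> w) = 1"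
    by (simp_all add: has_bochner_integral_iff)
  have \<phi>_cont: "continuous_on UNIV ?\<phi>"
    using continuous_on_berezin_weight[OF continuous_on_id] by simp
  then have \<phi>_meas [measurable]: "?\<phi> \<in> borel_measurable borel"
    by (rule borel_measurable_continuous_onI)
  have \<phi>_meas' [measurable]: "(\<lambda>w. ?\<phi> (w - z)) \<in> borel_measurable lebesgue" for z
    by (rule measurable_completion) simp
  obtain K where K: "\<And>w. ?\<phi> w \<le> K"
    using berezin_weight_bounded[OF assms(1)] by blast
  obtain C k where k: "integrable lebesgue k" "AE w in lebesgue. cmod (f w) \<le> C + k w"
    using Lp_fun_dominated[OF assms(3,2)] by blast
  note conv = convolution_bounded[OF \<phi>_int(1) berezin_weight_nonneg K f_meas k]
  have berezin_f: "berezin n f z = (LINT w|lebesgue. ?\<phi> (w - z) *\<^sub>R f w)" for z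
    by (rule berezin_eq[OF assms(1) f_meas])
  show ?thesis
  proof
    assume fixed: "AE z in lebesgue. berezin n f z = f z"
    let ?g = "berezin n f"
    obtain B where B: "\<And>z. cmod (?g z) \<le> B"
      using conv(2) unfolding berezin_f by blast
    have "B \<ge> 0" using norm_ge_zero B by (rule order_trans)
    \<comment> \<open>Almost everywhere \<open>f\<close> equals \<open>?g\<close>, so truncation at
      \<open>B\<close> changes it on a null set only, while supplying the bound at every point that
      the uniform continuity lemma demands.\<close>
    define f1 where "f1 w = (if cmod (f w) \<le> B then f w else 0)" for w
    have f1_meas [measurable]: "f1 \<in> borel_measurable lebesgue"
      unfolding f1_def by measurable
    have f1: "AE w in lebesgue. f1 w = f w"
      using fixed by eventually_elim (metis B f1_def)
    have g_f1: "?g z = (LINT w|lebesgue. ?\<phi> (w - z) *\<^sub>R f1 w)" for z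
      unfolding berezin_f by (rule integral_cong_AE) (use f1 in auto)
    have uc: "uniformly_continuous_on UNIV ?g"
      unfolding g_f1[abs_def]
      by (rule uniformly_continuous_convolution[where C = B]) (use \<open>B \<ge> 0\<close> in \<open>auto simp: f1_def \<phi>_cont \<phi>_int\<close>)
    then have g_meas [measurable]: "?g \<in> borel_measurable borel"
      by (intro borel_measurable_continuous_onI uniformly_continuous_imp_continuous)
    have g_meas' [measurable]: "?g \<in> borel_measurable lebesgue"
      by (rule measurable_completion) simp
    \<comment> \<open>The integral does not see null sets, so the almost everywhere identity becomes
      a fixed-point equation at every \<open>z\<close>.\<close>
    have "?g z = (LINT w|lebesgue. ?\<phi> (w - z) *\<^sub>R ?g w)" for z
      unfolding berezin_f[of z] by (rule integral_cong_AE) (use fixed in auto)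
    then have inv: "?g z = (LINT w|lborel. ?\<phi> w *\<^sub>R ?g (z + w))" for z
      unfolding convolution_centered(1)[OF \<phi>_meas g_meas] .
    have int: "integrable lborel (\<lambda>w. ?\<phi> w *\<^sub>R ?g (z + w))" for z
    proof (rule convolution_centered(2)[OF \<phi>_meas g_meas])
      show "integrable lebesgue (\<lambda>w. ?\<phi> (w - z) *\<^sub>R ?g w)"
        using B by (intro convolution_bounded(1)[OF \<phi>_int(1) berezin_weight_nonneg K, where C = B and k = "\<lambda>_. 0"]) auto
    qed
    \<comment> \<open>The supremum argument is for real functions; \<open>u\<close> stands for the
      real and the imaginary part.\<close>
    have const: "u (?g z) = u (?g 0)"
      if u: "bounded_linear u" and le: "\<And>x. \<bar>u x\<bar> \<le> cmod x" for u :: "complex \<Rightarrow> real" and z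
    proof (rule choquet_deny[OF \<phi>_mass berezin_weight_nonneg])
      show "isCont ?\<phi> 0"
        using \<phi>_cont by (simp add: continuous_on_eq_continuous_at)
      show "?\<phi> 0 > 0" by (rule berezin_weight_at_0[OF assms(1)])
      show "\<bar>u (?g x)\<bar> \<le> B" for x
        using le B by (rule order_trans)
      show "uniformly_continuous_on UNIV (\<lambda>x. u (?g x))"
        using bounded_linear.uniformly_continuous_on[OF u uc] .
      show "u (?g x) = (LINT w|lborel. ?\<phi> w * u (?g (x + w)))" for x
        by (subst inv, subst integral_bounded_linear[OF u int, symmetric])
          (simp add: linear_scale[OF bounded_linear.linear[OF u]])
    qed
    have g_const: "?g z = ?g 0" for z
      using const[OF bounded_linear_Re abs_Re_le_cmod] const[OF bounded_linear_Im abs_Im_le_cmod]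
      by (simp add: complex_eq_iff)
    from fixed have "AE z in lebesgue. f z = ?g 0"
      by eventually_elim (metis g_const)
    then show "\<exists>h. h harmonic_on UNIV \<and> (AE z in lebesgue. f z = h z)"
      by (intro exI[of _ "\<lambda>_. ?g 0"]) (simp add: harmonic_const)
  next
    assume "\<exists>h. h harmonic_on UNIV \<and> (AE z in lebesgue. f z = h z)"
    then obtain h where h: "h harmonic_on UNIV" and fh: "AE z in lebesgue. f z = h z"
      by blast
    have h_meas [measurable]: "h \<in> borel_measurable borel"
      by (intro borel_measurable_continuous_onI harmonic_imp_continuous h)
    have h_meas' [measurable]: "h \<in> borel_measurable lebesgue"
      by (rule measurable_completion) simp
    have "berezin n f z = h z" for z
    proof -
      \<comment> \<open>The growth of \<open>h\<close> is controlled solely through its agreement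
        with \<open>f\<close> almost everywhere.\<close>
      have int: "integrable lebesgue (\<lambda>w. ?\<phi> (w - z) *\<^sub>R h w)"
        by (rule integrable_cong_AE[THEN iffD1, OF _ _ _ conv(1)]) (use fh in auto)
      have "berezin n f z = (LINT w|lebesgue. ?\<phi> (w - z) *\<^sub>R h w)"
        unfolding berezin_f by (rule integral_cong_AE) (use fh in auto)
      also have "\<dots> = (LINT w|lborel. ?\<phi> w *\<^sub>R h (z + w))"
        by (rule convolution_centered(1)[OF \<phi>_meas h_meas])
      also have "\<dots> = (LINT w|lborel. ?\<phi> w) *\<^sub>R h z"
        by (rule harmonic_radial_mean[OF h \<phi>_cont berezin_weight_rotate \<phi>_int(1)
              convolution_centered(2)[OF \<phi>_meas h_meas int]])
      finally show ?thesis by (simp add: \<phi>_int(2))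
    qed
    with fh show "AE z in lebesgue. berezin n f z = f z"
      by (metis (mono_tags, lifting) eventually_mono)
  qed
qed

end
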